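(* As $n\to\infty$ through the natural numbers, the coefficients $a_k$ in the asymptotic expansion $$n!\asymp\sqrt{2\pi n}\,e^{-n}n^n\Big(\sum_{k\ge 0}\frac{a_k}{n^k}\Big)$$ are given, for every integer $k\ge 0$, by $$a_k=\sum_{j=0}^{2k}(-1)^j\,\frac{S_3\big(2(j+k),j\big)}{2^{j+k}\,(j+k)!}.$$
   Context: For an integer $r\ge 1$ and integers $n,k\ge 0$, the $r$-associated Stirling number of the second kind $S_r(n,k)$ is the number of partitions of a set of $n$ elements into $k$ blocks, all with at least $r$ elements, with the convention $S_r(0,0)=1$. The asymptotic expansion is understood in the following sense: for any given integer $N\ge 0$, $$n!=\sqrt{2\pi n}\,e^{-n}n^n\Big(\sum_{k=0}^{N}\frac{a_k}{n^k}+R_{N+1}\Big),\qquad R_{N+1}=R_{N+1}(n)=O\Big(\frac{1}{n^{N+1}}\Big)\ \text{ as } n\to\infty.$$ Such an expansion exists and its coefficients are unique. *)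

theory Defs
  imports Complex_Main "HOL-Library.Disjoint_Sets" "HOL-Library.Landau_Symbols"
begin

text \<open>
  \<open>assoc_Stirling r n k\<close> is the \<open>r\<close>-associated Stirling number of the second kind
  \<open>S\<^sub>r(n, k)\<close>, intended for \<open>r \<ge> 1\<close>. The \<open>n\<close>-element ground set is \<open>{..<n}\<close>; blocks of a
  partition are nonempty by definition of \<^const>\<open>partition_on\<close>.
\<close>
definition assoc_Stirling :: "nat \<Rightarrow> nat \<Rightarrow> nat \<Rightarrow> nat" where
  "assoc_Stirling r n k =
     card {P. partition_on {..<n} P \<and> card P = k \<and> (\<forall>B\<in>P. r \<le> card B)}"

text \<open>The convention \<open>S\<^sub>r(0, 0) = 1\<close> is a consequence: the empty set has exactly one partition.\<close>
lemma assoc_Stirling_0_0: "assoc_Stirling r 0 0 = 1"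
proof -
  have "{P. partition_on {..<0::nat} P \<and> card P = 0 \<and> (\<forall>B\<in>P. r \<le> card B)} = {{}}"
    by (auto simp: partition_on_empty)
  then show ?thesis
    by (simp add: assoc_Stirling_def)
qed

text \<open>
  The factorisation is required only for \<open>n > 0\<close>, since the terms \<open>a\<^sub>k / n\<^sup>k\<close> are meaningless
  for \<open>n = 0\<close>.
\<close>
definition factorial_expansion :: "(nat \<Rightarrow> real) \<Rightarrow> bool" where
  "factorial_expansion a \<longleftrightarrow>
     (\<forall>N. \<exists>R :: nat \<Rightarrow> real.
        (\<forall>n>0. fact n = sqrt (2 * pi * real n) * exp (- real n) * real n ^ n *
                   ((\<Sum>k=0..N. a k / real n ^ k) + R n)) \<and>
        R \<in> O(\<lambda>n. 1 / real n ^ (N + 1)))"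

end

theory Submission
  imports Defs "HOL-Probability.Distributions"
begin

text \<open>
  The proof is Laplace's method with an explicit remainder. Substituting \<open>t = n * exp x\<close> in Euler's
  integral for \<open>\<Gamma> n = n! / n\<close> gives
  \<open>n! = n ^ (n + 1) * exp (- n) * (\<integral>x. exp (- n * (exp x - 1 - x)))\<close> over the whole real line
  (\<open>has_bochner_integral_fact\<close>). Write the exponent as \<open>- n * x\<^sup>2 / 2 - n * \<phi> x\<close> with
  \<open>\<phi> x = exp x - 1 - x - x\<^sup>2 / 2\<close>. The function \<open>\<phi>\<close> is the exponential generating function of a block
  with at least three elements, so \<open>\<phi> x ^ j / j!\<close> is that of the numbers \<open>S\<^sub>3(m, j)\<close>
  (\<open>fps_nth_exp_tail_power\<close>, from the recurrence that singles out the block of one element), and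
  formally
  \<open>exp (- n * \<phi> x) = (\<Sum>j m. (- n) ^ j * S\<^sub>3(m, j) * x ^ m / m!)\<close>.
  Integrated against the Gaussian \<open>exp (- n * x\<^sup>2 / 2)\<close>, odd powers of \<open>x\<close> vanish and
  \<open>x ^ (2 * p)\<close> contributes \<open>sqrt (2 * pi / n) * (2 * p)! / (2 ^ p * p! * n ^ p)\<close>. The term for
  \<open>j\<close> and \<open>m = 2 * p\<close> is therefore a multiple of \<open>n ^ (j - p)\<close>, and collecting \<open>p = j + k\<close> yields
  the stated formula for \<open>a\<^sub>k\<close>, where \<open>S\<^sub>3(2 * (j + k), j) = 0\<close> unless \<open>j \<le> 2 * k\<close>.

  To make this rigorous up to an error \<open>O(1 / n ^ L)\<close>, the double series is cut off at \<open>j < 2 * L\<close> and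
  \<open>m < 6 * L\<close>. The pointwise error (\<open>saddle_poly_bound\<close>) is at most a constant times
  \<open>n ^ (2 * L) * x ^ (6 * L) * exp (- n * x\<^sup>2 / 6)\<close>, whose integral is of order
  \<open>1 / (n ^ L * sqrt n)\<close>, plus an integrable function times \<open>exp (- (n - 1) / 6)\<close>.
  Uniqueness of the coefficients is a comparison of two expansions, one coefficient after the other.
\<close>

section \<open>Associated Stirling numbers\<close>

text \<open>
  The partitions counted by \<open>assoc_Stirling r (card A) k\<close>, over an arbitrary ground set \<open>A\<close>.
\<close>
definition block_partitions :: "nat \<Rightarrow> 'a set \<Rightarrow> nat \<Rightarrow> 'a set set set" where
  "block_partitions r A k = {P. partition_on A P \<and> card P = k \<and> (\<forall>B\<in>P. r \<le> card B)}"

lemma finite_block_partitions: "finite A \<Longrightarrow> finite (block_partitions r A k)"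
  unfolding block_partitions_def
  by (rule finite_subset[OF _ finitely_many_partition_on]) auto

lemma card_block_partitions_image_le:
  assumes "finite A" "inj_on f A"
  shows "card (block_partitions r A k) \<le> card (block_partitions r (f ` A) k)"
proof (rule card_inj_on_le)
  have inj1: "inj_on ((`) f) (Pow A)"
    using assms(2) by (rule inj_on_image_Pow)
  have inj2: "inj_on ((`) ((`) f)) (Pow (Pow A))"
    using inj1 by (rule inj_on_image_Pow)
  have sub: "block_partitions r A k \<subseteq> Pow (Pow A)"
    by (auto simp: block_partitions_def partition_on_def)
  show "inj_on ((`) ((`) f)) (block_partitions r A k)"
    using inj2 sub by (rule inj_on_subset)
  show "finite (block_partitions r (f ` A) k)"
    using assms by (intro finite_block_partitions) auto
  show "(`) ((`) f) ` block_partitions r A k \<subseteq> block_partitions r (f ` A) k"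
  proof safe
    fix P assume "P \<in> block_partitions r A k"
    then have P: "partition_on A P" "card P = k" "\<And>B. B \<in> P \<Longrightarrow> r \<le> card B"
      by (auto simp: block_partitions_def)
    have PA: "P \<subseteq> Pow A"
      using P(1) by (auto simp: partition_on_def)
    have "{} \<notin> (`) f ` P"
      using P(1) by (auto simp: partition_on_def)
    then have "partition_on (f ` A) ((`) f ` P)"
      using partition_on_inj_image[OF P(1) assms(2)] by simp
    moreover have "card ((`) f ` P) = k"
      using card_image[OF inj_on_subset[OF inj1 PA]] P(2) by simp
    moreover have "r \<le> card (f ` B)" if "B \<in> P" for B
    proof -
      have "inj_on f B"
        using assms(2) PA that by (meson PowD inj_on_subset subsetD)
      then show ?thesis
        using P(3)[OF that] by (simp add: card_image)
    qed
    ultimately show "(`) f ` P \<in> block_partitions r (f ` A) k"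
      by (auto simp: block_partitions_def)
  qed
qed

lemma card_block_partitions:
  assumes "finite A"
  shows "card (block_partitions r A k) = assoc_Stirling r (card A) k"
proof -
  obtain f where f: "bij_betw f A {..<card A}"
    using ex_bij_betw_finite_nat[OF assms] by (auto simp: atLeast0LessThan)
  have 1: "inj_on f A" "f ` A = {..<card A}"
    using f by (auto simp: bij_betw_def)
  have 2: "inj_on (inv_into A f) {..<card A}" "inv_into A f ` {..<card A} = A"
    using bij_betw_inv_into[OF f] by (auto simp: bij_betw_def)
  have "card (block_partitions r A k) = card (block_partitions r {..<card A} k)"
    using card_block_partitions_image_le[OF assms 1(1), of r k]
      card_block_partitions_image_le[OF _ 2(1), of r k] 1(2) 2(2) by simp
  then show ?thesis
    by (simp add: block_partitions_def assoc_Stirling_def)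
qed

text \<open>
  Removing the block \<open>insert x C\<close> that contains a distinguished element \<open>x\<close> leaves a partition
  of the remaining elements \<open>A - C\<close>.
\<close>
lemma card_block_partitions_insert:
  assumes "finite A" "x \<notin> A"
  shows "card (block_partitions (Suc r) (insert x A) (Suc k)) =
    (\<Sum>C | C \<subseteq> A \<and> r \<le> card C. card (block_partitions (Suc r) (A - C) k))"
proof -
  define F where "F C = insert (insert x C) ` block_partitions (Suc r) (A - C) k" for C
  let ?I = "{C. C \<subseteq> A \<and> r \<le> card C}"
  have finI: "finite ?I"
    using assms(1) by simp
  have fresh: "insert x C \<notin> Q" if "Q \<in> block_partitions (Suc r) (A - D) k" for C D Q
    using that assms(2) by (auto simp: block_partitions_def partition_on_def)
  have "block_partitions (Suc r) (insert x A) (Suc k) = (\<Union>C\<in>?I. F C)"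
  proof (intro equalityI subsetI)
    fix P assume P: "P \<in> block_partitions (Suc r) (insert x A) (Suc k)"
    then have part: "partition_on (insert x A) P" and cardP: "card P = Suc k"
      and big: "\<And>B. B \<in> P \<Longrightarrow> Suc r \<le> card B"
      by (auto simp: block_partitions_def)
    from part obtain B where B: "B \<in> P" "x \<in> B"
      by (auto simp: partition_on_def)
    define C where "C = B - {x}"
    have BC: "B = insert x C" and xC: "x \<notin> C"
      using B by (auto simp: C_def)
    have CA: "C \<subseteq> A"
      using part B by (auto simp: C_def partition_on_def)
    have finC: "finite C"
      using CA assms(1) finite_subset by blast
    have "r \<le> card C"
      using big[OF B(1)] finC xC by (simp add: BC)
    then have CI: "C \<in> ?I"
      using CA by simp
    define Q where "Q = P - {B}"
    have PQ: "P = insert B Q" "B \<notin> Q"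
      using B by (auto simp: Q_def)
    have "disjnt B (\<Union>Q)"
      using part B by (auto simp: Q_def partition_on_def disjnt_def disjoint_def)
    then have "partition_on (insert x A - B) Q"
      using partition_on_insert part PQ(1) by metis
    moreover have "insert x A - B = A - C"
      using assms(2) by (auto simp: BC)
    moreover have "finite P"
      using cardP card.infinite by fastforce
    ultimately have "Q \<in> block_partitions (Suc r) (A - C) k"
      using cardP PQ big by (auto simp: block_partitions_def)
    then have "P \<in> F C"
      using PQ(1) BC by (auto simp: F_def)
    with CI show "P \<in> (\<Union>C\<in>?I. F C)"
      by blast
  next
    fix P assume "P \<in> (\<Union>C\<in>?I. F C)"
    then obtain C Q where C: "C \<subseteq> A" "r \<le> card C"
      and Q: "Q \<in> block_partitions (Suc r) (A - C) k" and P: "P = insert (insert x C) Q"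
      by (auto simp: F_def)
    have Qp: "partition_on (A - C) Q" "card Q = k"
      using Q by (auto simp: block_partitions_def)
    have finC: "finite C"
      using C(1) assms(1) finite_subset by blast
    have xC: "x \<notin> C"
      using C(1) assms(2) by blast
    have "disjnt (insert x C) (\<Union>Q)"
      using Qp(1) assms(2) by (auto simp: partition_on_def disjnt_def)
    moreover have "insert x A - insert x C = A - C"
      using assms(2) by auto
    ultimately have "partition_on (insert x A) P"
      unfolding P using Qp(1) C(1) by (subst partition_on_insert) auto
    moreover have "finite Q"
      using Qp(1) assms(1) by (meson finite_Diff finite_elements)
    then have "card P = Suc k"
      using fresh[OF Q] Qp(2) by (simp add: P)
    ultimately show "P \<in> block_partitions (Suc r) (insert x A) (Suc k)"
      using C(2) finC xC Q by (auto simp: block_partitions_def P)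
  qed
  also have "card (\<Union>C\<in>?I. F C) = (\<Sum>C\<in>?I. card (F C))"
  proof (rule card_UN_disjoint[OF finI])
    show "\<forall>C\<in>?I. finite (F C)"
      using assms(1) by (auto simp: F_def intro!: finite_block_partitions)
    show "\<forall>C\<in>?I. \<forall>D\<in>?I. C \<noteq> D \<longrightarrow> F C \<inter> F D = {}"
    proof (intro ballI impI)
      fix C D assume CD: "C \<in> ?I" "D \<in> ?I" "C \<noteq> D"
      show "F C \<inter> F D = {}"
      proof (rule ccontr)
        assume "F C \<inter> F D \<noteq> {}"
        then obtain Q Q' where Q: "Q \<in> block_partitions (Suc r) (A - C) k"
          and Q': "Q' \<in> block_partitions (Suc r) (A - D) k"
          and eq: "insert (insert x C) Q = insert (insert x D) Q'"
          by (auto simp: F_def)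
        have "insert x C \<notin> Q'"
          by (rule fresh[OF Q'])
        then have "insert x C = insert x D"
          using eq by blast
        moreover have "x \<notin> C" "x \<notin> D"
          using CD assms(2) by auto
        ultimately show False
          using CD(3) by (metis insert_ident)
      qed
    qed
  qed
  also have "\<dots> = (\<Sum>C\<in>?I. card (block_partitions (Suc r) (A - C) k))"
  proof (rule sum.cong[OF refl])
    fix C
    have "inj_on (insert (insert x C)) (block_partitions (Suc r) (A - C) k)"
    proof (rule inj_onI)
      fix Q Q' assume "Q \<in> block_partitions (Suc r) (A - C) k" "Q' \<in> block_partitions (Suc r) (A - C) k"
        "insert (insert x C) Q = insert (insert x C) Q'"
      then show "Q = Q'"
        using fresh insert_ident by metis
    qed
    then show "card (F C) = card (block_partitions (Suc r) (A - C) k)"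
      by (simp add: F_def card_image)
  qed
  finally show ?thesis .
qed

lemma assoc_Stirling_Suc_Suc:
  "assoc_Stirling (Suc r) (Suc n) (Suc k) =
     (\<Sum>i=r..n. (n choose i) * assoc_Stirling (Suc r) (n - i) k)"
proof -
  let ?I = "{C. C \<subseteq> {..<n} \<and> r \<le> card C}"
  have "assoc_Stirling (Suc r) (Suc n) (Suc k) =
      card (block_partitions (Suc r) (insert n {..<n}) (Suc k))"
    by (simp add: card_block_partitions)
  also have "\<dots> = (\<Sum>C\<in>?I. card (block_partitions (Suc r) ({..<n} - C) k))"
    by (rule card_block_partitions_insert) auto
  also have "\<dots> = (\<Sum>C\<in>?I. assoc_Stirling (Suc r) (n - card C) k)"
    by (intro sum.cong refl)
      (auto simp: card_block_partitions card_Diff_subset finite_subset[OF _ finite_lessThan])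
  also have "\<dots> = (\<Sum>i=r..n. \<Sum>C | C \<in> ?I \<and> card C = i. assoc_Stirling (Suc r) (n - card C) k)"
    by (rule sum.group[symmetric]) (auto dest: card_mono[OF finite_lessThan])
  also have "\<dots> = (\<Sum>i=r..n. (n choose i) * assoc_Stirling (Suc r) (n - i) k)"
  proof (rule sum.cong[OF refl])
    fix i assume i: "i \<in> {r..n}"
    have "{C. C \<in> ?I \<and> card C = i} = {C. C \<subseteq> {..<n} \<and> card C = i}"
      using i by auto
    then show "(\<Sum>C | C \<in> ?I \<and> card C = i. assoc_Stirling (Suc r) (n - card C) k) =
        (n choose i) * assoc_Stirling (Suc r) (n - i) k"
      using n_subsets[of "{..<n}" i] by simp
  qed
  finally show ?thesis .
qed

lemma assoc_Stirling_n_0: "assoc_Stirling r n 0 = (if n = 0 then 1 else 0)"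
proof (cases "n = 0")
  case True
  then show ?thesis
    by (simp add: assoc_Stirling_0_0)
next
  case False
  have "P \<noteq> {} \<and> finite P" if "partition_on {..<n} P" for P
    using that False finite_elements[OF _ that] by (auto simp: partition_on_def)
  then have "{P. partition_on {..<n} P \<and> card P = 0 \<and> (\<forall>B\<in>P. r \<le> card B)} = {}"
    by auto
  then show ?thesis
    using False by (simp only: assoc_Stirling_def card.empty if_False)
qed

lemma assoc_Stirling_eq_0:
  assumes "n < r * k"
  shows "assoc_Stirling r n k = 0"
proof -
  have False if P: "partition_on {..<n} P" "card P = k" "\<forall>B\<in>P. r \<le> card B" for P
  proof -
    have "finite B" if "B \<in> P" for B
      using P(1) that by (metis Union_upper finite_lessThan finite_subset partition_onD1)
    then have "n = (\<Sum>B\<in>P. card B)"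
      using P(1) card_Union_disjoint[of P] by (auto simp: partition_on_def disjoint_def disjnt_def pairwise_def)
    also have "\<dots> \<ge> r * k"
      using sum_mono[of P "\<lambda>_. r" card] P by (simp add: mult.commute)
    finally show False
      using assms by simp
  qed
  then have "{P. partition_on {..<n} P \<and> card P = k \<and> (\<forall>B\<in>P. r \<le> card B)} = {}"
    by blast
  then show ?thesis
    by (simp only: assoc_Stirling_def card.empty)
qed

section \<open>The exponential generating function\<close>

text \<open>
  The series of \<open>e\<^sup>X\<close> without its terms of degree below \<open>r\<close>: the exponential generating
  function of a single block with at least \<open>r\<close> elements.
\<close>
definition exp_tail_fps :: "nat \<Rightarrow> real fps" where
  "exp_tail_fps r = Abs_fps (\<lambda>i. if r \<le> i then 1 / fact i else 0)"

text \<open>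
  The coefficient of \<open>X\<^sup>m\<close> in the derivative of the power \<open>k + 1\<close> is a convolution that satisfies
  the recurrence of \<open>assoc_Stirling_Suc_Suc\<close>; the minimal block size is written as a successor so
  that the series has constant term \<open>0\<close>.
\<close>
lemma fps_nth_exp_tail_power:
  "fps_nth (exp_tail_fps (Suc r) ^ k) n =
     fact k * real (assoc_Stirling (Suc r) n k) / fact n"
proof (induction k arbitrary: n)
  case 0
  then show ?case
    by (simp add: assoc_Stirling_n_0)
next
  case (Suc k)
  let ?F = "exp_tail_fps (Suc r)"
  show ?case
  proof (cases n)
    case 0
    then show ?thesis
      by (simp add: exp_tail_fps_def assoc_Stirling_eq_0)
  next
    case (Suc m)
    have "real (Suc m) * fps_nth (?F ^ Suc k) (Suc m) = fps_nth (fps_deriv (?F ^ Suc k)) m"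
      by (simp only: fps_deriv_nth Suc_eq_plus1)
    also have "fps_deriv (?F ^ Suc k) = fps_const (real (Suc k)) * (fps_deriv ?F * ?F ^ k)"
      by (simp only: fps_deriv_power diff_Suc_1 mult.assoc)
    also have "fps_nth \<dots> m = real (Suc k) * (\<Sum>i=0..m. fps_nth (fps_deriv ?F) i * fps_nth (?F ^ k) (m - i))"
      unfolding fps_mult_left_const_nth by (simp only: fps_mult_nth)
    also have "(\<Sum>i=0..m. fps_nth (fps_deriv ?F) i * fps_nth (?F ^ k) (m - i)) =
        (\<Sum>i=r..m. fps_nth (fps_deriv ?F) i * fps_nth (?F ^ k) (m - i))"
      by (rule sum.mono_neutral_right) (auto simp: exp_tail_fps_def)
    also have "\<dots> = (\<Sum>i=r..m. fact k / fact m * real ((m choose i) * assoc_Stirling (Suc r) (m - i) k))"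
    proof (rule sum.cong[OF refl])
      fix i assume i: "i \<in> {r..m}"
      have "fps_nth (fps_deriv ?F) i = 1 / fact i"
        using i by (simp add: exp_tail_fps_def fact_Suc field_simps del: of_nat_Suc)
      then show "fps_nth (fps_deriv ?F) i * fps_nth (?F ^ k) (m - i) =
          fact k / fact m * real ((m choose i) * assoc_Stirling (Suc r) (m - i) k)"
        using i Suc.IH[of "m - i"] by (simp add: binomial_fact)
    qed
    also have "\<dots> = fact k / fact m * real (assoc_Stirling (Suc r) (Suc m) (Suc k))"
      by (simp only: assoc_Stirling_Suc_Suc of_nat_sum sum_distrib_left)
    finally have "real (Suc m) * fps_nth (?F ^ Suc k) (Suc m) =
        real (Suc k) * (fact k / fact m * real (assoc_Stirling (Suc r) (Suc m) (Suc k)))" .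
    then show ?thesis
      unfolding Suc by (simp add: fact_Suc field_simps del: of_nat_Suc power_Suc)
  qed
qed

lemma exp_tail_fps_3:
  "exp_tail_fps 3 = fps_exp 1 - fps_of_poly [:1, 1, 1 / 2:]"
proof (rule fps_ext)
  fix n :: nat
  consider "n = 0" | "n = 1" | "n = 2" | "n \<ge> 3" by linarith
  then show "fps_nth (exp_tail_fps 3) n = fps_nth (fps_exp 1 - fps_of_poly [:1, 1, 1 / 2:]) n"
  proof cases
    case 4
    then have "n = Suc (Suc (Suc (n - 3)))" by simp
    then obtain m where "n = Suc (Suc (Suc m))" by blast
    then show ?thesis
      by (simp add: exp_tail_fps_def coeff_pCons del: fact_Suc)
  qed (auto simp: exp_tail_fps_def numeral_2_eq_2)
qed

lemma fps_conv_radius_exp_tail_3: "fps_conv_radius (exp_tail_fps 3) = \<infinity>"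
  using fps_conv_radius_diff[of "fps_exp (1::real)" "fps_of_poly [:1, 1, 1 / 2:]"]
  by (simp add: exp_tail_fps_3)

lemma fps_conv_radius_exp_tail_3_power: "fps_conv_radius (exp_tail_fps 3 ^ j) = \<infinity>"
  using fps_conv_radius_power[of "exp_tail_fps 3" j] by (simp add: fps_conv_radius_exp_tail_3)

lemma eval_exp_tail_3: "eval_fps (exp_tail_fps 3) x = exp x - 1 - x - x\<^sup>2 / 2"
  unfolding exp_tail_fps_3
  by (subst eval_fps_diff) (auto simp: power2_eq_square algebra_simps)

lemma eval_fps_remainder_bound:
  fixes f :: "real fps"
  assumes "fps_conv_radius f > 1"
  shows "\<exists>C\<ge>0. \<forall>x. \<bar>x\<bar> \<le> 1 \<longrightarrow>
    \<bar>eval_fps f x - (\<Sum>m<K. fps_nth f m * x ^ m)\<bar> \<le> C * \<bar>x\<bar> ^ K"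
proof (intro exI conjI allI impI)
  let ?C = "\<Sum>m. \<bar>fps_nth f (m + K)\<bar>"
  have conv: "ereal (norm x) < fps_conv_radius f" if "\<bar>x\<bar> \<le> 1" for x :: real
    using that assms by (metis ereal_less_eq(3) one_ereal_def order_le_less_trans real_norm_def)
  have sum1: "summable (\<lambda>m. \<bar>fps_nth f (m + K)\<bar>)"
    using norm_summable_fps[OF conv[of 1]] by (subst summable_iff_shift) simp
  show "?C \<ge> 0"
    using sum1 by (rule suminf_nonneg) simp
  fix x :: real assume x: "\<bar>x\<bar> \<le> 1"
  have s: "summable (\<lambda>m. fps_nth f m * x ^ m)"
    by (rule summable_fps[OF conv[OF x]])
  have le: "norm (fps_nth f (m + K) * x ^ (m + K)) \<le> \<bar>fps_nth f (m + K)\<bar> * \<bar>x\<bar> ^ K" for m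
  proof -
    have "\<bar>x\<bar> ^ (m + K) \<le> \<bar>x\<bar> ^ K"
      using x by (intro power_decreasing) auto
    then show ?thesis
      by (simp add: abs_mult power_abs mult_left_mono)
  qed
  have "eval_fps f x - (\<Sum>m<K. fps_nth f m * x ^ m) = (\<Sum>m. fps_nth f (m + K) * x ^ (m + K))"
    using suminf_minus_initial_segment[OF s, of K] by (simp add: eval_fps_def)
  also have "\<bar>\<dots>\<bar> \<le> (\<Sum>m. \<bar>fps_nth f (m + K)\<bar> * \<bar>x\<bar> ^ K)"
    using norm_suminf_le[OF le] sum1 by (simp add: summable_mult2)
  also have "\<dots> = ?C * \<bar>x\<bar> ^ K"
    using sum1 by (simp add: suminf_mult2)
  finally show "\<bar>eval_fps f x - (\<Sum>m<K. fps_nth f m * x ^ m)\<bar> \<le> ?C * \<bar>x\<bar> ^ K" .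
qed

lemma exp_tail_power_expansion:
  "\<exists>C\<ge>0. \<forall>x::real. \<bar>x\<bar> \<le> 1 \<longrightarrow>
    \<bar>(exp x - 1 - x - x\<^sup>2 / 2) ^ j / fact j - (\<Sum>m<K. real (assoc_Stirling 3 m j) / fact m * x ^ m)\<bar>
      \<le> C * \<bar>x\<bar> ^ K"
proof -
  let ?G = "fps_const (1 / fact j) * exp_tail_fps 3 ^ j"
  have rad: "fps_conv_radius ?G = \<infinity>"
    by (simp add: fps_conv_radius_cmult_left fps_conv_radius_exp_tail_3_power)
  have "eval_fps ?G x = (exp x - 1 - x - x\<^sup>2 / 2) ^ j / fact j" for x
    by (subst eval_fps_mult)
      (auto simp: eval_fps_power fps_conv_radius_exp_tail_3 fps_conv_radius_exp_tail_3_power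
        eval_exp_tail_3)
  moreover have "fps_nth ?G m = real (assoc_Stirling 3 m j) / fact m" for m
    using fps_nth_exp_tail_power[of 2 j m] by (simp add: numeral_3_eq_3 numeral_2_eq_2)
  ultimately show ?thesis
    using eval_fps_remainder_bound[of ?G K] rad by simp
qed

section \<open>Estimating the integrand\<close>

lemma exp_tail_3_le:
  fixes x :: real
  assumes "\<bar>x\<bar> \<le> 1"
  shows "\<bar>exp x - 1 - x - x\<^sup>2 / 2\<bar> \<le> \<bar>x\<bar> ^ 3 / 3"
proof -
  obtain t where t: "\<bar>t\<bar> \<le> \<bar>x\<bar>" "exp x = (\<Sum>m<4. x ^ m / fact m) + exp t / fact 4 * x ^ 4"
    using Maclaurin_exp_le[of x 4] by blast
  have "exp t \<le> exp 1"
    using t(1) assms by simp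
  \<comment> \<open>The constant \<open>1 / 3\<close> of the claim is below \<open>1 / 2\<close>, the coefficient of the Gaussian exponent;
    with \<open>exp 1 \<le> 3\<close>, the fourth-order remainder yields \<open>1 / 6 + 1 / 8\<close>.\<close>
  then have et: "exp t \<le> 3"
    using exp_le by linarith
  have x4: "x ^ 4 \<le> \<bar>x\<bar> ^ 3"
    using power_decreasing[of 3 4 "\<bar>x\<bar>"] assms by simp
  have "exp x - 1 - x - x\<^sup>2 / 2 = x ^ 3 / 6 + exp t / 24 * x ^ 4"
  proof -
    have "(\<Sum>m<4. x ^ m / fact m) = 1 + x + x\<^sup>2 / 2 + x ^ 3 / 6"
      by (simp add: numeral_eq_Suc)
    moreover have "fact 4 = (24 :: real)"
      by (simp add: fact_numeral)
    ultimately show ?thesis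
      using t(2) by simp
  qed
  also have "\<bar>\<dots>\<bar> \<le> \<bar>x\<bar> ^ 3 / 6 + exp t / 24 * x ^ 4"
    by (rule order_trans[OF abs_triangle_ineq]) (simp add: abs_mult power_abs)
  also have "exp t / 24 * x ^ 4 \<le> 3 / 24 * \<bar>x\<bar> ^ 3"
    using et x4 by (intro mult_mono) auto
  finally show ?thesis
    using zero_le_power[of "\<bar>x\<bar>" 3] by linarith
qed

lemma exp_minus_linear_ge:
  fixes x :: real
  assumes "\<bar>x\<bar> \<ge> 1"
  shows "exp x - 1 - x \<ge> 1 / 6"
proof (cases "x \<ge> 0")
  case True
  then have "1 \<le> x\<^sup>2"
    using assms by (simp add: one_le_power)
  then show ?thesis
    using exp_lower_Taylor_quadratic[OF True] by simp
next
  case False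
  then have x: "x \<le> -1"
    using assms by simp
  \<comment> \<open>For \<open>x \<le> -1\<close> the tangent of \<open>exp\<close> at \<open>-1\<close> lies below \<open>exp x\<close>.\<close>
  have e: "exp (-1) \<ge> (1 / 3 :: real)"
    using exp_le by (simp add: exp_minus field_simps)
  have "exp (-1) \<le> (1 :: real)"
    by simp
  then have "0 \<le> (1 - exp (-1 :: real)) * (-1 - x)"
    using x by (intro mult_nonneg_nonneg) auto
  moreover have "exp x = exp (-1) * exp (x + 1)"
    by (simp flip: exp_add)
  moreover have "exp (-1) * (1 + (x + 1)) \<le> exp (-1) * exp (x + 1)"
    by (intro mult_left_mono exp_ge_add_one_self) auto
  ultimately show ?thesis
    using e by (simp add: algebra_simps)
qed

text \<open>
  With \<open>\<phi> x = exp x - 1 - x - x\<^sup>2 / 2\<close>, this is the exponential series of \<open>exp (- n * \<phi> x)\<close>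
  truncated below order \<open>2 * L\<close>, each power \<open>\<phi> x ^ j / fact j\<close> in turn being replaced by its Taylor
  polynomial of degree below \<open>6 * L\<close>. The degree \<open>6 * L\<close> is the one at which both truncation errors
  are bounded by the same term \<open>n ^ (2*L) * x ^ (6*L)\<close>, which is even in \<open>x\<close>.
\<close>
definition saddle_poly :: "nat \<Rightarrow> real \<Rightarrow> real \<Rightarrow> real" where
  "saddle_poly L n x =
     (\<Sum>j<2*L. (-n) ^ j * (\<Sum>m<6*L. real (assoc_Stirling 3 m j) / fact m * x ^ m))"

text \<open>
  For \<open>\<bar>x\<bar> \<le> 1\<close> the bound \<open>\<bar>\<phi> x\<bar> \<le> \<bar>x\<bar> ^ 3 / 3\<close> lets the Gaussian factor \<open>exp (- n * x\<^sup>2 / 2)\<close>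
  absorb \<open>exp (n * \<bar>\<phi> x\<bar>)\<close>, with \<open>exp (- n * x\<^sup>2 / 6)\<close> left over. For \<open>\<bar>x\<bar> \<ge> 1\<close> the two terms of
  the difference are bounded separately: the polynomial there is at most a multiple of its
  dominating power \<open>x ^ (6*L)\<close>, so no separate estimate of a Gaussian tail is needed, and
  the integrand is exponentially small in \<open>n\<close>.
\<close>
lemma saddle_poly_bound:
  "\<exists>C\<ge>0. \<forall>n\<ge>1. \<forall>x.
     \<bar>exp (- n * (exp x - 1 - x)) - exp (- n * x\<^sup>2 / 2) * saddle_poly L n x\<bar>
       \<le> C * n ^ (2*L) * x ^ (6*L) * exp (- n * x\<^sup>2 / 6)
         + exp (- (n - 1) / 6) * exp (- (exp x - 1 - x))"
proof -
  let ?s = "\<lambda>m j. real (assoc_Stirling 3 m j) / fact m"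
  let ?phi = "\<lambda>x::real. exp x - 1 - x - x\<^sup>2 / 2"
  define R where "R j x = \<bar>?phi x ^ j / fact j - (\<Sum>m<6*L. ?s m j * x ^ m)\<bar>" for j x
  \<comment> \<open>\<open>D j\<close> bounds the Taylor remainder of \<open>\<phi> ^ j / fact j\<close>, and \<open>E\<close> serves the case \<open>\<bar>x\<bar> \<ge> 1\<close>.\<close>
  have "\<forall>j. \<exists>C. C \<ge> 0 \<and> (\<forall>x. \<bar>x\<bar> \<le> 1 \<longrightarrow> R j x \<le> C * \<bar>x\<bar> ^ (6*L))"
    unfolding R_def by (rule allI, rule exp_tail_power_expansion)
  from choice[OF this] obtain D
    where "\<forall>j. D j \<ge> 0 \<and> (\<forall>x. \<bar>x\<bar> \<le> 1 \<longrightarrow> R j x \<le> D j * \<bar>x\<bar> ^ (6*L))" ..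
  then have D0: "\<And>j. D j \<ge> 0"
    and D: "\<And>j x. \<bar>x\<bar> \<le> 1 \<Longrightarrow> R j x \<le> D j * \<bar>x\<bar> ^ (6*L)"
    by auto
  define E where "E = (\<Sum>j<2*L. \<Sum>m<6*L. ?s m j)"
  define C where "C = 1 + (\<Sum>j<2*L. D j) + E"
  have E0: "E \<ge> 0"
    unfolding E_def by (intro sum_nonneg) auto
  have SD0: "(\<Sum>j<2*L. D j) \<ge> 0"
    using D0 by (intro sum_nonneg) auto
  have "\<bar>exp (- n * (exp x - 1 - x)) - exp (- n * x\<^sup>2 / 2) * saddle_poly L n x\<bar>
       \<le> C * n ^ (2*L) * x ^ (6*L) * exp (- n * x\<^sup>2 / 6)
         + exp (- (n - 1) / 6) * exp (- (exp x - 1 - x))" (is "?lhs \<le> ?rhs1 + ?rhs2")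
    if n: "n \<ge> 1" for n x :: real
  proof -
    have x6: "\<bar>x\<bar> ^ (6*L) = x ^ (6*L)"
      by (intro power_even_abs) auto
    have x6': "x ^ (6*L) \<ge> 0"
      by (simp add: x6[symmetric])
    have nj: "n ^ j \<le> n ^ (2*L)" if "j < 2*L" for j
      using n that by (intro power_increasing) auto
    have gauss: "exp (- n * x\<^sup>2 / 2) \<le> exp (- n * x\<^sup>2 / 6)"
      using n by (simp add: field_simps)
    show ?thesis
    proof (cases "\<bar>x\<bar> \<le> 1")
      case True
      define y where "y = - n * ?phi x"
      have absphi: "\<bar>?phi x\<bar> \<le> \<bar>x\<bar> ^ 3 / 3"
        by (rule exp_tail_3_le[OF True])
      have "\<bar>x\<bar> ^ 3 \<le> x\<^sup>2"
        using power_decreasing[of 2 3 "\<bar>x\<bar>"] True by simp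
      then have y1: "\<bar>y\<bar> \<le> n * x\<^sup>2 / 3"
        using absphi n by (simp add: y_def abs_mult)
      have "\<bar>?phi x\<bar> \<le> \<bar>x\<bar> ^ 3"
        using absphi zero_le_power[of "\<bar>x\<bar>" 3] by linarith
      then have "\<bar>y\<bar> \<le> n * \<bar>x\<bar> ^ 3"
        using n by (simp add: y_def abs_mult)
      then have "\<bar>y\<bar> ^ (2*L) \<le> (n * \<bar>x\<bar> ^ 3) ^ (2*L)"
        by (rule power_mono) simp
      then have y2: "\<bar>y\<bar> ^ (2*L) \<le> n ^ (2*L) * x ^ (6*L)"
        by (simp add: power_mult_distrib x6 flip: power_mult)
      obtain t where t: "\<bar>t\<bar> \<le> \<bar>y\<bar>"
        "exp y = (\<Sum>j<2*L. y ^ j / fact j) + exp t / fact (2*L) * y ^ (2*L)"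
        using Maclaurin_exp_le[of y "2*L"] by blast
      have "\<bar>exp y - (\<Sum>j<2*L. y ^ j / fact j)\<bar> = exp t / fact (2*L) * \<bar>y\<bar> ^ (2*L)"
        using t(2) by (simp add: abs_mult power_abs)
      also have "\<dots> \<le> exp (n * x\<^sup>2 / 3) * (n ^ (2*L) * x ^ (6*L))"
      proof (intro mult_mono y2)
        have "exp t / fact (2*L) \<le> exp t / 1"
          by (intro divide_left_mono) auto
        also have "\<dots> \<le> exp (n * x\<^sup>2 / 3)"
          using t(1) y1 by simp
        finally show "exp t / fact (2*L) \<le> exp (n * x\<^sup>2 / 3)" .
      qed auto
      finally have e1: "\<bar>exp y - (\<Sum>j<2*L. y ^ j / fact j)\<bar>
          \<le> exp (n * x\<^sup>2 / 3) * (n ^ (2*L) * x ^ (6*L))" .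
      have "(\<Sum>j<2*L. y ^ j / fact j) - saddle_poly L n x =
          (\<Sum>j<2*L. (-n) ^ j * (?phi x ^ j / fact j - (\<Sum>m<6*L. ?s m j * x ^ m)))"
        unfolding saddle_poly_def y_def power_mult_distrib
        by (simp only: sum_subtractf right_diff_distrib times_divide_eq_right)
      also have "\<bar>\<dots>\<bar> \<le> (\<Sum>j<2*L. n ^ (2*L) * (D j * x ^ (6*L)))"
      proof (rule order_trans[OF sum_abs], rule sum_mono)
        fix j assume "j \<in> {..<2*L}"
        then have "n ^ j \<le> n ^ (2*L)"
          using nj by simp
        then show "\<bar>(-n) ^ j * (?phi x ^ j / fact j - (\<Sum>m<6*L. ?s m j * x ^ m))\<bar>
            \<le> n ^ (2*L) * (D j * x ^ (6*L))"
          using D[OF True, of j] n unfolding abs_mult x6[symmetric] R_def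
          by (intro mult_mono) (auto simp: power_abs)
      qed
      also have "\<dots> = (\<Sum>j<2*L. D j) * (n ^ (2*L) * x ^ (6*L))"
        by (simp add: sum_distrib_left sum_distrib_right mult_ac)
      finally have e2: "\<bar>(\<Sum>j<2*L. y ^ j / fact j) - saddle_poly L n x\<bar>
          \<le> (\<Sum>j<2*L. D j) * (n ^ (2*L) * x ^ (6*L))" .
      have "- n * x\<^sup>2 / 2 + n * x\<^sup>2 / 3 = - n * x\<^sup>2 / 6"
        by simp
      then have ee: "exp (- n * x\<^sup>2 / 2) * exp (n * x\<^sup>2 / 3) = exp (- n * x\<^sup>2 / 6)"
        by (simp only: exp_add[symmetric])
      have "exp (- n * (exp x - 1 - x)) = exp (- n * x\<^sup>2 / 2) * exp y"
        by (simp add: y_def algebra_simps flip: exp_add)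
      then have "?lhs = exp (- n * x\<^sup>2 / 2) * \<bar>exp y - saddle_poly L n x\<bar>"
        by (simp add: abs_mult flip: right_diff_distrib)
      also have "\<dots> \<le> exp (- n * x\<^sup>2 / 2) * (exp (n * x\<^sup>2 / 3) * (n ^ (2*L) * x ^ (6*L)) +
          (\<Sum>j<2*L. D j) * (n ^ (2*L) * x ^ (6*L)))"
        using e1 e2 by (intro mult_left_mono) auto
      also have "\<dots> = exp (- n * x\<^sup>2 / 6) * (n ^ (2*L) * x ^ (6*L)) +
          exp (- n * x\<^sup>2 / 2) * ((\<Sum>j<2*L. D j) * (n ^ (2*L) * x ^ (6*L)))"
        by (simp only: ee[symmetric] distrib_left mult.assoc)
      also have "\<dots> \<le> exp (- n * x\<^sup>2 / 6) * (n ^ (2*L) * x ^ (6*L)) +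
          exp (- n * x\<^sup>2 / 6) * ((\<Sum>j<2*L. D j) * (n ^ (2*L) * x ^ (6*L)))"
        using gauss n x6' SD0 by (intro add_mono mult_right_mono order_refl) auto
      also have "\<dots> = (1 + (\<Sum>j<2*L. D j)) * (n ^ (2*L) * x ^ (6*L) * exp (- n * x\<^sup>2 / 6))"
        by (simp add: algebra_simps)
      also have "\<dots> \<le> C * (n ^ (2*L) * x ^ (6*L) * exp (- n * x\<^sup>2 / 6))"
        using E0 n x6' by (intro mult_right_mono) (auto simp: C_def)
      also have "\<dots> \<le> ?rhs1 + ?rhs2"
        by (simp add: mult.assoc)
      finally show ?thesis .
    next
      case False
      then have x1: "\<bar>x\<bar> \<ge> 1"
        by simp
      have "(n - 1) * (1 / 6) \<le> (n - 1) * (exp x - 1 - x)"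
        using exp_minus_linear_ge[OF x1] n by (intro mult_left_mono) auto
      then have "- n * (exp x - 1 - x) \<le> - (n - 1) / 6 + - (exp x - 1 - x)"
        by (simp add: algebra_simps diff_divide_distrib)
      then have a: "exp (- n * (exp x - 1 - x)) \<le> ?rhs2"
        by (simp flip: exp_add)
      have "\<bar>saddle_poly L n x\<bar> \<le> (\<Sum>j<2*L. n ^ (2*L) * (\<Sum>m<6*L. ?s m j * x ^ (6*L)))"
        unfolding saddle_poly_def
      proof (rule order_trans[OF sum_abs], rule sum_mono)
        fix j assume "j \<in> {..<2*L}"
        then have "n ^ j \<le> n ^ (2*L)"
          using nj by simp
        moreover have "\<bar>\<Sum>m<6*L. ?s m j * x ^ m\<bar> \<le> (\<Sum>m<6*L. ?s m j * x ^ (6*L))"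
        proof (rule order_trans[OF sum_abs], rule sum_mono)
          fix m assume "m \<in> {..<6*L}"
          then have "\<bar>x\<bar> ^ m \<le> \<bar>x\<bar> ^ (6*L)"
            using x1 by (intro power_increasing) auto
          then show "\<bar>?s m j * x ^ m\<bar> \<le> ?s m j * x ^ (6*L)"
            unfolding x6[symmetric] abs_mult power_abs by (intro mult_mono) auto
        qed
        ultimately show "\<bar>(-n) ^ j * (\<Sum>m<6*L. ?s m j * x ^ m)\<bar>
            \<le> n ^ (2*L) * (\<Sum>m<6*L. ?s m j * x ^ (6*L))"
          using n unfolding abs_mult by (intro mult_mono) (auto simp: power_abs)
      qed
      also have "\<dots> = E * (n ^ (2*L) * x ^ (6*L))"
        by (simp add: E_def sum_distrib_left sum_distrib_right mult_ac)
      also have "\<dots> \<le> C * (n ^ (2*L) * x ^ (6*L))"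
        using SD0 n x6' by (intro mult_right_mono) (auto simp: C_def)
      finally have "exp (- n * x\<^sup>2 / 2) * \<bar>saddle_poly L n x\<bar>
          \<le> exp (- n * x\<^sup>2 / 6) * (C * (n ^ (2*L) * x ^ (6*L)))"
        using gauss by (intro mult_mono) auto
      then have b: "exp (- n * x\<^sup>2 / 2) * \<bar>saddle_poly L n x\<bar> \<le> ?rhs1"
        by (simp add: mult_ac)
      have "?lhs \<le> exp (- n * (exp x - 1 - x)) + exp (- n * x\<^sup>2 / 2) * \<bar>saddle_poly L n x\<bar>"
        by (rule order_trans[OF abs_triangle_ineq4]) (simp add: abs_mult)
      then show ?thesis
        using a b by linarith
    qed
  qed
  moreover have "C \<ge> 0"
    using E0 SD0 by (simp add: C_def)
  ultimately show ?thesis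
    by blast
qed

section \<open>Integrals\<close>

text \<open>
  Euler's integral for \<open>\<Gamma> n = n! / n\<close> under the substitution \<open>t = n * exp x\<close>, which maps the real line
  onto the positive reals and moves the maximum of the integrand to \<open>x = 0\<close>.
\<close>
lemma has_bochner_integral_fact:
  assumes "n > 0"
  shows "has_bochner_integral lborel (\<lambda>x::real. exp (- real n * (exp x - 1 - x)))
    (fact n * exp (real n) / real n ^ Suc n)"
proof -
  define f where "f = (\<lambda>t::real. t powr (real n - 1) / exp t)"
  define g where "g x = real n * exp x" for x :: real
  define h where "h x = exp (- real n * (exp x - 1 - x))" for x :: real
  let ?c = "real n ^ n / exp (real n)"
  have g_pos: "g x > 0" for x
    using assms by (simp add: g_def)
  have "Gamma (real n) = fact n / real n"
    using assms Gamma_fact[of "n - 1", where 'a = real] by (cases n) (auto simp: add.commute)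
  then have "(f has_integral (fact n / real n)) {0..}"
    using Gamma_integral_real[of "real n"] assms by (simp add: f_def)
  then have "(f has_integral (fact n / real n)) {0<..}"
    by (rule iffD1[OF has_integral_spike_set_eq, rotated 2]) (auto intro: negligible_subset[of "{0}"])
  moreover have "f absolutely_integrable_on {0<..}"
    using calculation by (intro nonnegative_absolutely_integrable_1) (auto simp: f_def)
  moreover have "range g = {0<..}"
  proof (intro equalityI subsetI)
    fix t :: real assume "t \<in> {0<..}"
    then have "t = g (ln (t / real n))"
      using assms by (simp add: g_def)
    then show "t \<in> range g"
      by blast
  qed (use g_pos in auto)
  ultimately have "f absolutely_integrable_on range g \<and> integral (range g) f = fact n / real n"
    by (auto simp: integral_unique)
  moreover have "(g has_field_derivative g x) (at x within UNIV)" for x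
    unfolding g_def by (auto intro!: derivative_eq_intros)
  moreover have "inj g"
    using assms by (auto simp: g_def inj_on_def)
  ultimately have "(\<lambda>x. \<bar>g x\<bar> * f (g x)) absolutely_integrable_on UNIV \<and>
      integral UNIV (\<lambda>x. \<bar>g x\<bar> * f (g x)) = fact n / real n"
    using has_absolute_integral_change_of_variables_1'[of UNIV g g f "fact n / real n"] by simp
  moreover have "\<bar>g x\<bar> * f (g x) = ?c * h x" for x
  proof -
    have "g x * g x powr (real n - 1) = g x powr real n"
      using g_pos[of x] by (simp add: powr_diff)
    also have "\<dots> = real n ^ n * exp (real n * x)"
      using g_pos[of x] by (simp add: powr_realpow) (simp add: g_def power_mult_distrib exp_of_nat_mult)
    finally have "\<bar>g x\<bar> * f (g x) = real n ^ n * (exp (real n * x) / exp (g x))"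
      using g_pos[of x] by (simp add: f_def)
    also have "exp (real n * x) / exp (g x) = h x / exp (real n)"
      by (simp add: h_def g_def algebra_simps flip: exp_diff)
    finally show ?thesis
      by simp
  qed
  ultimately have I: "(\<lambda>x. ?c * h x) absolutely_integrable_on UNIV"
    "integral UNIV (\<lambda>x. ?c * h x) = fact n / real n"
    by simp_all
  have meas: "(\<lambda>x. ?c * h x) \<in> borel_measurable lborel"
    by (simp add: h_def)
  have int: "integrable lebesgue (\<lambda>x. ?c * h x)"
    using I(1) by (simp add: set_integrable_def)
  then have "integrable lborel (\<lambda>x. ?c * h x)"
    by (simp only: integrable_completion[OF meas])
  moreover have "integral\<^sup>L lborel (\<lambda>x. ?c * h x) = fact n / real n"
    using I(2) by (simp only: integral_lebesgue[OF int] integral_completion[OF meas])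
  ultimately have "has_bochner_integral lborel (\<lambda>x. ?c * h x) (fact n / real n)"
    by (simp only: has_bochner_integral_iff)
  from has_bochner_integral_mult_right[where c = "1 / ?c", OF this]
  show ?thesis
    using assms by (simp add: h_def mult_ac)
qed

lemma normal_density_precision:
  assumes "a > 0"
  shows "exp (- a * x\<^sup>2 / 2) = sqrt (2 * pi / a) * normal_density 0 (1 / sqrt a) x"
  using assms by (simp add: normal_density_def power_divide real_sqrt_divide)

lemma has_bochner_integral_gaussian_even:
  assumes "a > (0::real)"
  shows "has_bochner_integral lborel (\<lambda>x. exp (- a * x\<^sup>2 / 2) * x ^ (2 * k))
    (sqrt (2 * pi / a) * (fact (2 * k) / ((2 * a) ^ k * fact k)))"
proof -
  have "has_bochner_integral lborel (\<lambda>x. normal_density 0 (1 / sqrt a) x * (x - 0) ^ (2 * k))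
      (fact (2 * k) / ((2 / (1 / sqrt a)\<^sup>2) ^ k * fact k))"
    using assms by (intro normal_moment_even) simp
  then have "has_bochner_integral lborel (\<lambda>x. normal_density 0 (1 / sqrt a) x * x ^ (2 * k))
      (fact (2 * k) / ((2 * a) ^ k * fact k))"
    using assms by (simp add: power_divide)
  from has_bochner_integral_mult_right[where c = "sqrt (2 * pi / a)", OF this]
  show ?thesis
    unfolding normal_density_precision[OF assms] by (simp add: mult.assoc)
qed

lemma has_bochner_integral_gaussian_odd:
  assumes "a > (0::real)"
  shows "has_bochner_integral lborel (\<lambda>x. exp (- a * x\<^sup>2 / 2) * x ^ Suc (2 * k)) 0"
proof -
  have "has_bochner_integral lborel (\<lambda>x. normal_density 0 (1 / sqrt a) x * (x - 0) ^ (2 * k + 1)) 0"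
    using assms by (intro normal_moment_odd) simp
  from has_bochner_integral_mult_right[where c = "sqrt (2 * pi / a)", OF this]
  show ?thesis
    unfolding normal_density_precision[OF assms] by (simp add: mult.assoc)
qed

text \<open>
  Up to the factor \<open>sqrt (2 * pi / n) * n ^ j / n ^ p\<close>, the Gaussian integral of the term of
  \<^const>\<open>saddle_poly\<close> with indices \<open>j\<close> and \<open>m = 2 * p\<close>; terms with odd \<open>m\<close> integrate to \<open>0\<close>.
\<close>
definition saddle_coeff :: "nat \<Rightarrow> nat \<Rightarrow> real" where
  "saddle_coeff p j = (- 1) ^ j * real (assoc_Stirling 3 (2 * p) j) / (2 ^ p * fact p)"

lemma saddle_coeff_eq_0: "2 * p < 3 * j \<Longrightarrow> saddle_coeff p j = 0"
  by (simp add: saddle_coeff_def assoc_Stirling_eq_0)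

lemma has_bochner_integral_saddle_poly:
  assumes n: "n > (0::real)"
  shows "has_bochner_integral lborel (\<lambda>x. exp (- n * x\<^sup>2 / 2) * saddle_poly L n x)
    (sqrt (2 * pi / n) * (\<Sum>j<2*L. \<Sum>p<3*L. saddle_coeff p j * n ^ j / n ^ p))"
proof -
  define G where "G m = (if even m then sqrt (2 * pi / n) * (fact m / ((2 * n) ^ (m div 2) * fact (m div 2))) else 0)" for m
  have G: "has_bochner_integral lborel (\<lambda>x. exp (- n * x\<^sup>2 / 2) * x ^ m) (G m)" for m
  proof (cases "even m")
    case True
    then obtain k where "m = 2 * k" ..
    then show ?thesis
      using has_bochner_integral_gaussian_even[OF n, of k] by (simp add: G_def)
  next
    case False
    then obtain k where "m = Suc (2 * k)"
      by (auto elim: oddE)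
    then show ?thesis
      using has_bochner_integral_gaussian_odd[OF n, of k] by (simp add: G_def)
  qed
  have even_part: "(\<Sum>m<2*K. c m * G m) = (\<Sum>p<K. c (2 * p) * G (2 * p))" for c K
    by (induction K) (simp_all add: G_def)
  have "has_bochner_integral lborel
      (\<lambda>x. \<Sum>j<2*L. \<Sum>m<2*(3*L). ((-n) ^ j * (real (assoc_Stirling 3 m j) / fact m)) * (exp (- n * x\<^sup>2 / 2) * x ^ m))
      (\<Sum>j<2*L. \<Sum>m<2*(3*L). ((-n) ^ j * (real (assoc_Stirling 3 m j) / fact m)) * G m)"
    by (intro has_bochner_integral_sum has_bochner_integral_mult_right G)
  also have "(\<lambda>x. \<Sum>j<2*L. \<Sum>m<2*(3*L). ((-n) ^ j * (real (assoc_Stirling 3 m j) / fact m)) * (exp (- n * x\<^sup>2 / 2) * x ^ m))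
      = (\<lambda>x. exp (- n * x\<^sup>2 / 2) * saddle_poly L n x)"
    by (simp add: saddle_poly_def sum_distrib_left mult_ac)
  also have "(\<Sum>j<2*L. \<Sum>m<2*(3*L). ((-n) ^ j * (real (assoc_Stirling 3 m j) / fact m)) * G m)
      = (\<Sum>j<2*L. \<Sum>p<3*L. ((-n) ^ j * (real (assoc_Stirling 3 (2 * p) j) / fact (2 * p))) * G (2 * p))"
    by (simp only: even_part)
  also have "\<dots> = (\<Sum>j<2*L. \<Sum>p<3*L. sqrt (2 * pi / n) * (saddle_coeff p j * n ^ j / n ^ p))"
    by (intro sum.cong refl)
      (use n in \<open>simp add: G_def saddle_coeff_def power_mult_distrib power_minus[of n] field_simps\<close>)
  finally show ?thesis
    by (simp add: sum_distrib_left)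
qed

text \<open>The closed form of the coefficients \<open>a\<^sub>k\<close>, in which \<open>p = j + k\<close>.\<close>
definition factorial_coeff :: "nat \<Rightarrow> real" where
  "factorial_coeff k = (\<Sum>j=0..2*k. (- 1) ^ j * real (assoc_Stirling 3 (2 * (j + k)) j) /
                                   (2 ^ (j + k) * fact (j + k)))"

text \<open>
  Collecting the double sum by \<open>k = p - j\<close>: since \<open>saddle_coeff p j\<close> vanishes for \<open>2 * p < 3 * j\<close>,
  only \<open>k \<ge> 0\<close> and \<open>j \<le> 2 * k\<close> matter, and the ranges of \<open>j\<close> and \<open>p\<close> contain all such pairs
  with \<open>k < L\<close>. The remaining terms have \<open>k \<ge> L\<close>.
\<close>
lemma saddle_sum_bound:
  assumes n: "n \<ge> (1::real)"
  shows "\<bar>(\<Sum>j<2*L. \<Sum>p<3*L. saddle_coeff p j * n ^ j / n ^ p) - (\<Sum>k<L. factorial_coeff k / n ^ k)\<bar>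
    \<le> (\<Sum>j<2*L. \<Sum>p<3*L. \<bar>saddle_coeff p j\<bar>) / n ^ L"
proof -
  have coeff: "factorial_coeff k = (\<Sum>j<2*L. saddle_coeff (j + k) j)" if "k < L" for k
  proof -
    have "factorial_coeff k = (\<Sum>j=0..2*k. saddle_coeff (j + k) j)"
      by (simp add: factorial_coeff_def saddle_coeff_def)
    also have "\<dots> = (\<Sum>j<2*L. saddle_coeff (j + k) j)"
      using that by (intro sum.mono_neutral_left) (auto intro!: saddle_coeff_eq_0)
    finally show ?thesis .
  qed
  have "(\<Sum>k<L. factorial_coeff k / n ^ k) = (\<Sum>k<L. \<Sum>j<2*L. saddle_coeff (j + k) j / n ^ k)"
    by (intro sum.cong refl) (simp add: coeff sum_divide_distrib)
  also have "\<dots> = (\<Sum>j<2*L. \<Sum>k<L. saddle_coeff (j + k) j / n ^ k)"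
    by (rule sum.swap)
  also have "\<dots> = (\<Sum>j<2*L. \<Sum>p=j..<j+L. saddle_coeff p j * n ^ j / n ^ p)"
  proof (rule sum.cong[OF refl])
    fix j
    have "(\<Sum>p=j..<j+L. saddle_coeff p j * n ^ j / n ^ p) =
        (\<Sum>k<L. saddle_coeff (k + j) j * n ^ j / n ^ (k + j))"
      using sum.shift_bounds_nat_ivl[of "\<lambda>p. saddle_coeff p j * n ^ j / n ^ p" 0 j L]
      by (simp add: add.commute atLeast0LessThan)
    then show "(\<Sum>k<L. saddle_coeff (j + k) j / n ^ k) = (\<Sum>p=j..<j+L. saddle_coeff p j * n ^ j / n ^ p)"
      using n by (simp add: power_add add.commute)
  qed
  finally have "(\<Sum>j<2*L. \<Sum>p<3*L. saddle_coeff p j * n ^ j / n ^ p) - (\<Sum>k<L. factorial_coeff k / n ^ k)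
      = (\<Sum>j<2*L. (\<Sum>p<3*L. saddle_coeff p j * n ^ j / n ^ p) - (\<Sum>p=j..<j+L. saddle_coeff p j * n ^ j / n ^ p))"
    by (simp add: sum_subtractf)
  also have "\<dots> = (\<Sum>j<2*L. \<Sum>p\<in>{..<3*L} - {j..<j+L}. saddle_coeff p j * n ^ j / n ^ p)"
    by (intro sum.cong refl sum_diff[symmetric]) auto
  also have "\<bar>\<dots>\<bar> \<le> (\<Sum>j<2*L. \<Sum>p\<in>{..<3*L} - {j..<j+L}. \<bar>saddle_coeff p j * n ^ j / n ^ p\<bar>)"
    by (rule order_trans[OF sum_abs]) (intro sum_mono sum_abs)
  also have "\<dots> \<le> (\<Sum>j<2*L. \<Sum>p\<in>{..<3*L} - {j..<j+L}. \<bar>saddle_coeff p j\<bar> / n ^ L)"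
  proof (intro sum_mono)
    fix j p assume "p \<in> {..<3*L} - {j..<j+L}"
    then consider "p < j" | "j + L \<le> p"
      by fastforce
    then show "\<bar>saddle_coeff p j * n ^ j / n ^ p\<bar> \<le> \<bar>saddle_coeff p j\<bar> / n ^ L"
    proof cases
      case 1
      then show ?thesis
        by (simp add: saddle_coeff_eq_0)
    next
      case 2
      have "n ^ (j + L) \<le> n ^ p"
        using n 2 by (intro power_increasing) auto
      then have "\<bar>saddle_coeff p j\<bar> * n ^ (j + L) \<le> \<bar>saddle_coeff p j\<bar> * n ^ p"
        by (rule mult_left_mono) simp
      then show ?thesis
        using n by (simp add: abs_mult power_add field_simps)
    qed
  qed
  also have "\<dots> \<le> (\<Sum>j<2*L. \<Sum>p<3*L. \<bar>saddle_coeff p j\<bar> / n ^ L)"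
    using n by (intro sum_mono sum_mono2) auto
  finally show ?thesis
    by (simp add: sum_divide_distrib)
qed

section \<open>The expansion\<close>

lemma exp_minus_le_inverse_power:
  fixes y :: real
  assumes "y > 0" "m > 0"
  shows "exp (- y) \<le> (real m / y) ^ m"
proof -
  have "y / real m \<le> exp (y / real m)"
    using exp_ge_add_one_self[of "y / real m"] by linarith
  then have "(y / real m) ^ m \<le> exp (y / real m) ^ m"
    using assms by (intro power_mono) auto
  also have "\<dots> = exp y"
    using assms by (intro exp_divide_power_eq) auto
  finally have "inverse (exp y) \<le> inverse ((y / real m) ^ m)"
    using assms by (intro le_imp_inverse_le) auto
  then show ?thesis
    by (simp add: exp_minus power_inverse[symmetric] inverse_divide)
qed

text \<open>
  The exponent \<open>Suc L\<close> instead of \<open>L\<close> pays for the crude estimate \<open>sqrt (n / (2 * pi)) \<le> n\<close>.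
\<close>
lemma sqrt_times_exp_decay_le:
  assumes "n \<ge> (1::real)"
  shows "sqrt (n / (2 * pi)) * exp (- (n - 1) / 6) \<le> exp (1 / 6) * (6 * real (Suc L)) ^ Suc L / n ^ L"
proof -
  have "sqrt (n / (2 * pi)) \<le> sqrt (n\<^sup>2)"
  proof (rule real_sqrt_le_mono)
    have "n / (2 * pi) \<le> n / 1"
      using assms pi_gt3 by (intro divide_left_mono) auto
    also have "n / 1 \<le> n\<^sup>2"
      using assms by (simp add: power2_eq_square)
    finally show "n / (2 * pi) \<le> n\<^sup>2" .
  qed
  then have 1: "sqrt (n / (2 * pi)) \<le> n"
    using assms by simp
  have "exp (- (n / 6)) \<le> (real (Suc L) / (n / 6)) ^ Suc L"
    using assms by (intro exp_minus_le_inverse_power) auto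
  also have "\<dots> = (6 * real (Suc L)) ^ Suc L / n ^ Suc L"
    by (simp only: power_divide[symmetric]) (simp add: mult.commute)
  finally have "exp (1 / 6) * exp (- (n / 6)) \<le> exp (1 / 6) * ((6 * real (Suc L)) ^ Suc L / n ^ Suc L)"
    by (rule mult_left_mono) simp
  moreover have "exp (1 / 6) * exp (- (n / 6)) = exp (- (n - 1) / 6)"
    by (simp add: diff_divide_distrib flip: exp_add)
  ultimately have 2: "exp (- (n - 1) / 6) \<le> exp (1 / 6) * ((6 * real (Suc L)) ^ Suc L / n ^ Suc L)"
    by simp
  have "sqrt (n / (2 * pi)) * exp (- (n - 1) / 6) \<le>
      n * (exp (1 / 6) * ((6 * real (Suc L)) ^ Suc L / n ^ Suc L))"
    using assms 1 2 by (intro mult_mono) auto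
  then show ?thesis
    using assms by simp
qed

text \<open>
  Integrating \<open>saddle_poly_bound\<close> and multiplying by \<open>sqrt (n / (2 * pi))\<close> gives three error terms of
  order \<open>1 / n ^ L\<close>: \<open>B1\<close> comes from the moment of order \<open>6 * L\<close> of the Gaussian
  \<open>exp (- n * x\<^sup>2 / 6)\<close>, \<open>B2\<close> from the exponentially small term, and \<open>B3\<close> from \<open>saddle_sum_bound\<close>.
\<close>
lemma factorial_remainder_bound:
  "\<exists>B. \<forall>n>0. \<bar>fact n / (sqrt (2 * pi * real n) * exp (- real n) * real n ^ n)
      - (\<Sum>k<L. factorial_coeff k / real n ^ k)\<bar> \<le> B / real n ^ L"
proof -
  obtain C where C: "C \<ge> 0" "\<And>n x. n \<ge> 1 \<Longrightarrow>
     \<bar>exp (- n * (exp x - 1 - x)) - exp (- n * x\<^sup>2 / 2) * saddle_poly L n x\<bar>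
       \<le> C * n ^ (2*L) * x ^ (6*L) * exp (- n * x\<^sup>2 / 6)
         + exp (- (n - 1) / 6) * exp (- (exp x - 1 - x))"
    using saddle_poly_bound[of L] by blast
  define T where "T n = (\<Sum>j<2*L. \<Sum>p<3*L. saddle_coeff p j * n ^ j / n ^ p)" for n
  define c where "c = (fact (6*L) / fact (3*L) :: real)"
  define B1 where "B1 = C * (sqrt 3 * c * (3 / 2) ^ (3*L))"
  define B2 where "B2 = exp (1 / 6) * (6 * real (Suc L)) ^ Suc L * exp (1::real)"
  define B3 where "B3 = (\<Sum>j<2*L. \<Sum>p<3*L. \<bar>saddle_coeff p j\<bar>)"
  have "\<bar>fact n / (sqrt (2 * pi * real n) * exp (- real n) * real n ^ n)
      - (\<Sum>k<L. factorial_coeff k / real n ^ k)\<bar> \<le> (B1 + B2 + B3) / real n ^ L" if "n > 0" for n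
  proof -
    define q where "q = real n"
    define I where "I = fact n * exp q / q ^ Suc n"
    have q: "q \<ge> 1" "q > 0"
      using that by (auto simp: q_def)
    have intI: "has_bochner_integral lborel (\<lambda>x. exp (- q * (exp x - 1 - x))) I"
      unfolding q_def I_def by (rule has_bochner_integral_fact[OF that])
    note intS = has_bochner_integral_saddle_poly[OF q(2), of L, folded T_def]
    have intD: "has_bochner_integral lborel
        (\<lambda>x. exp (- q * (exp x - 1 - x)) - exp (- q * x\<^sup>2 / 2) * saddle_poly L q x)
        (I - sqrt (2 * pi / q) * T q)"
      by (rule has_bochner_integral_diff[OF intI intS])
    \<comment> \<open>\<open>exp (- q * x\<^sup>2 / 6)\<close> is the Gaussian with \<open>q\<close> replaced by \<open>q / 3\<close>.\<close>
    have gauss: "has_bochner_integral lborel (\<lambda>x. exp (- (q / 3) * x\<^sup>2 / 2) * x ^ (2 * (3*L)))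
       (sqrt (2 * pi / (q / 3)) * (fact (2 * (3*L)) / ((2 * (q / 3)) ^ (3*L) * fact (3*L))))"
      using q by (intro has_bochner_integral_gaussian_even) simp
    \<comment> \<open>The case \<open>n = 1\<close> of the integral representation evaluates the tail integral.\<close>
    have one: "has_bochner_integral lborel (\<lambda>x::real. exp (- (exp x - 1 - x))) (exp 1)"
      using has_bochner_integral_fact[of 1] by simp
    have "has_bochner_integral lborel
       (\<lambda>x. C * q ^ (2*L) * (exp (- (q / 3) * x\<^sup>2 / 2) * x ^ (2 * (3*L)))
          + exp (- (q - 1) / 6) * exp (- (exp x - 1 - x)))
       (C * q ^ (2*L) * (sqrt (2 * pi / (q / 3)) * (fact (2 * (3*L)) / ((2 * (q / 3)) ^ (3*L) * fact (3*L))))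
         + exp (- (q - 1) / 6) * exp 1)"
      by (intro has_bochner_integral_add has_bochner_integral_mult_right gauss one)
    moreover have "C * q ^ (2*L) * (sqrt (2 * pi / (q / 3)) * (fact (2 * (3*L)) / ((2 * (q / 3)) ^ (3*L) * fact (3*L))))
        = sqrt (2 * pi / q) * (B1 / q ^ L)"
    proof -
      have "sqrt (2 * pi / (q / 3)) = sqrt (2 * pi / q) * sqrt 3"
        by (simp flip: real_sqrt_mult)
      moreover have "(2 * (q / 3)) ^ (3*L) = q ^ (2*L) * q ^ L / (3 / 2) ^ (3*L)"
        by (simp add: power_mult_distrib power_divide flip: power_add)
      ultimately show ?thesis
        using q by (simp add: B1_def c_def mult_ac)
    qed
    ultimately have intR: "has_bochner_integral lborel
       (\<lambda>x. C * q ^ (2*L) * x ^ (6*L) * exp (- q * x\<^sup>2 / 6)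
          + exp (- (q - 1) / 6) * exp (- (exp x - 1 - x)))
       (sqrt (2 * pi / q) * (B1 / q ^ L) + exp (- (q - 1) / 6) * exp 1)"
      by (simp add: mult_ac)
    have "\<bar>I - sqrt (2 * pi / q) * T q\<bar> \<le> sqrt (2 * pi / q) * (B1 / q ^ L) + exp (- (q - 1) / 6) * exp 1"
      unfolding has_bochner_integral_integral_eq[OF intD, symmetric]
        has_bochner_integral_integral_eq[OF intR, symmetric]
      by (intro integral_abs_bound_integral C(2) q integrable.intros[OF intD] integrable.intros[OF intR])
    then have "sqrt (q / (2 * pi)) * \<bar>I - sqrt (2 * pi / q) * T q\<bar> \<le>
        sqrt (q / (2 * pi)) * (sqrt (2 * pi / q) * (B1 / q ^ L) + exp (- (q - 1) / 6) * exp 1)"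
      using q by (intro mult_left_mono) auto
    moreover have inv: "sqrt (q / (2 * pi)) * sqrt (2 * pi / q) = 1"
      using q by (simp flip: real_sqrt_mult)
    moreover have "sqrt (q / (2 * pi)) * \<bar>I - sqrt (2 * pi / q) * T q\<bar> = \<bar>sqrt (q / (2 * pi)) * I - T q\<bar>"
    proof -
      have "sqrt (q / (2 * pi)) * I - T q = sqrt (q / (2 * pi)) * (I - sqrt (2 * pi / q) * T q)"
        by (simp only: right_diff_distrib mult.assoc[symmetric] inv mult_1_left)
      then show ?thesis
        using q by (simp add: abs_mult)
    qed
    moreover have "sqrt (q / (2 * pi)) * (sqrt (2 * pi / q) * (B1 / q ^ L) + exp (- (q - 1) / 6) * exp 1)
        = B1 / q ^ L + sqrt (q / (2 * pi)) * exp (- (q - 1) / 6) * exp 1"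
      by (simp only: distrib_left mult.assoc[symmetric] inv mult_1_left)
    ultimately have "\<bar>sqrt (q / (2 * pi)) * I - T q\<bar> \<le>
        B1 / q ^ L + sqrt (q / (2 * pi)) * exp (- (q - 1) / 6) * exp 1"
      by (simp only:)
    also have "sqrt (q / (2 * pi)) * exp (- (q - 1) / 6) * exp 1 \<le> B2 / q ^ L"
      using mult_right_mono[OF sqrt_times_exp_decay_le[OF q(1), of L], of "exp 1"]
      by (simp add: B2_def)
    finally have "\<bar>sqrt (q / (2 * pi)) * I - T q\<bar> \<le> B1 / q ^ L + B2 / q ^ L"
      by simp
    moreover have "\<bar>T q - (\<Sum>k<L. factorial_coeff k / q ^ k)\<bar> \<le> B3 / q ^ L"
      unfolding T_def B3_def by (rule saddle_sum_bound[OF q(1)])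
    ultimately have "\<bar>sqrt (q / (2 * pi)) * I - (\<Sum>k<L. factorial_coeff k / q ^ k)\<bar> \<le> (B1 + B2 + B3) / q ^ L"
      by (simp add: add_divide_distrib)
    moreover have "sqrt (q / (2 * pi)) * I = fact n / (sqrt (2 * pi * q) * exp (- q) * q ^ n)"
    proof -
      have "sqrt (q / (2 * pi)) * sqrt (2 * pi * q) = q"
        using q by (simp flip: real_sqrt_mult)
      then have "sqrt (q / (2 * pi)) = q / sqrt (2 * pi * q)"
        using q by (simp add: field_simps)
      then show ?thesis
        using q by (simp add: I_def exp_minus field_simps)
    qed
    ultimately show ?thesis
      by (simp add: q_def)
  qed
  then show ?thesis
    by blast
qed

lemma factorial_expansion_factorial_coeff: "factorial_expansion factorial_coeff"
  unfolding factorial_expansion_def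
proof
  fix N
  define s where "s n = sqrt (2 * pi * real n) * exp (- real n) * real n ^ n" for n
  define R where "R n = fact n / s n - (\<Sum>k=0..N. factorial_coeff k / real n ^ k)" for n
  obtain B where "\<forall>n>0. \<bar>fact n / s n - (\<Sum>k<Suc N. factorial_coeff k / real n ^ k)\<bar> \<le> B / real n ^ Suc N"
    using factorial_remainder_bound[of "Suc N"] unfolding s_def by blast
  then have B: "\<bar>R n\<bar> \<le> B / real n ^ Suc N" if "n > 0" for n
    using that by (simp add: R_def lessThan_Suc_atMost atLeast0AtMost)
  have "R \<in> O(\<lambda>n. 1 / real n ^ (N + 1))"
  proof (rule bigoI)
    show "\<forall>\<^sub>F n in sequentially. norm (R n) \<le> B * norm (1 / real n ^ (N + 1))"
      using eventually_gt_at_top[of 0] by eventually_elim (use B in simp)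
  qed
  moreover have "fact n = s n * ((\<Sum>k=0..N. factorial_coeff k / real n ^ k) + R n)" if "n > 0" for n
    using that by (simp add: R_def s_def)
  ultimately show "\<exists>R. (\<forall>n>0. fact n = sqrt (2 * pi * real n) * exp (- real n) * real n ^ n *
      ((\<Sum>k=0..N. factorial_coeff k / real n ^ k) + R n)) \<and> R \<in> O(\<lambda>n. 1 / real n ^ (N + 1))"
    unfolding s_def by blast
qed

lemma factorial_expansion_unique:
  assumes "factorial_expansion a" "factorial_expansion b"
  shows "a = b"
proof
  fix k
  show "a k = b k"
  proof (induction k rule: less_induct)
    case (less k)
    obtain R where R: "R \<in> O(\<lambda>n. 1 / real n ^ (k + 1))" "\<And>n. n > 0 \<Longrightarrow>
        fact n = sqrt (2 * pi * real n) * exp (- real n) * real n ^ n * ((\<Sum>i=0..k. a i / real n ^ i) + R n)"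
      using assms(1) unfolding factorial_expansion_def by blast
    obtain S where S: "S \<in> O(\<lambda>n. 1 / real n ^ (k + 1))" "\<And>n. n > 0 \<Longrightarrow>
        fact n = sqrt (2 * pi * real n) * exp (- real n) * real n ^ n * ((\<Sum>i=0..k. b i / real n ^ i) + S n)"
      using assms(2) unfolding factorial_expansion_def by blast
    have diff: "(a k - b k) / real n ^ k = S n - R n" if "n > 0" for n
    proof -
      have "sqrt (2 * pi * real n) * exp (- real n) * real n ^ n \<noteq> 0"
        using that by simp
      then have "(\<Sum>i=0..k. a i / real n ^ i) + R n = (\<Sum>i=0..k. b i / real n ^ i) + S n"
        using R(2)[OF that] S(2)[OF that] by (metis mult_left_cancel)
      moreover have "(\<Sum>i=0..<k. a i / real n ^ i) = (\<Sum>i=0..<k. b i / real n ^ i)"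
        by (intro sum.cong refl) (simp add: less.IH)
      ultimately show ?thesis
        by (simp add: atLeastLessThanSuc_atLeastAtMost[symmetric] diff_divide_distrib)
    qed
    have "(\<lambda>n. S n - R n) \<in> O(\<lambda>n. 1 / real n ^ (k + 1))"
      using S(1) R(1) by (rule sum_in_bigo)
    then obtain c where c: "\<forall>\<^sub>F n in sequentially. norm (S n - R n) \<le> c * norm (1 / real n ^ (k + 1))"
      by (elim landau_o.bigE)
    have "\<forall>\<^sub>F n in sequentially. norm (a k - b k) \<le> c / real n"
      using c eventually_gt_at_top[of 0]
    proof eventually_elim
      case (elim n)
      then have "\<bar>a k - b k\<bar> / real n ^ k \<le> c / real n / real n ^ k"
        by (simp flip: diff)
      then have "\<bar>a k - b k\<bar> / real n ^ k * real n ^ k \<le> c / real n / real n ^ k * real n ^ k"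
        by (rule mult_right_mono) simp
      then show ?case
        using elim(2) by simp
    qed
    moreover have "(\<lambda>n. c / real n) \<longlonglongrightarrow> 0"
      by (rule lim_const_over_n)
    ultimately have "(\<lambda>n. a k - b k) \<longlonglongrightarrow> 0"
      by (rule Lim_null_comparison)
    then show "a k = b k"
      by (simp add: LIMSEQ_const_iff)
  qed
qed

theorem theorem2p4:
  shows "(\<exists>!a. factorial_expansion a) \<and>
    (\<forall>a. factorial_expansion a \<longrightarrow>
      (\<forall>k. a k = (\<Sum>j=0..2*k. (- 1) ^ j * real (assoc_Stirling 3 (2 * (j + k)) j) /
                                   (2 ^ (j + k) * fact (j + k)))))"
  using factorial_expansion_factorial_coeff factorial_expansion_unique
  unfolding factorial_coeff_def[symmetric] by blast

end
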